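(* Let $\mathcal G$ be a non-empty set of functions on $\Omega$, and let $$\mathcal L(F)=\sup_{G_1,G_2\in\mathcal G}E[F^+G_1+F^-G_2].$$ Let $c\ge0$, let $|\cdot|_p$ denote one of the three norms $|\cdot|_{L^1(\sigma)}$ or $|\cdot|_{L^1(\omega)}$ (case $p=1$), $|\cdot|_{L^\infty(\sigma+\omega)}$ (case $p=\infty$), and let $D^\pm$ denote either $D^+$ throughout or $D^-$ throughout. The following are equivalent: (i) $c\,\mathcal L(F)\le E[|D^\pm F|_p]$ for all $F:\Omega\to\mathbb R$; (ii) $c\,\mathcal L(1_A)\le E[|D^\pm1_A|_p]$ and $c\,\mathcal L(-1_A)\le E[|D^\pm(-1_A)|_p]$ for all $A\in\mathcal F$.
   Context: $X$ is a metric space with Borel $\sigma$-algebra $\mathcal B(X)$ and $\sigma$ is a finite diffuse (atomless) measure on $X$. $\Omega$ is the set of Radon measures $\omega=\sum_{i=1}^N\delta_{x_i}$ with pairwise distinct $x_i\in X$, $N\in\mathbb N\cup\{\infty\}$; $\omega$ is identified with the set $\{x_1,x_2,\dots\}$. $\mathcal F$ is the $\sigma$-algebra generated by the maps $\omega\mapsto\omega(B)$, $B\in\mathcal B(X)$, and $\pi$ is the Poisson measure on $(\Omega,\mathcal F)$ with intensity $\sigma$; $E$ is expectation under $\pi$. All functions on $\Omega$ are $\mathcal F$-measurable, and the functions $F$ considered are those for which the expectations defining $\mathcal L(F)$ make sense. $F^+=\max(F,0)$, $F^-=\max(-F,0)$. $D_xF(\omega)=(F(\omega)-F(\omega+\delta_x))1_{\{x\notin\omega\}}+(F(\omega)-F(\omega-\delta_x))1_{\{x\in\omega\}}$,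 $D_x^+F=\max(0,D_xF)$, $D_x^-F=-\min(0,D_xF)$. For each $\omega$, the norms of $x\mapsto D_x^\pm F(\omega)$ are taken on $X$: $|D^\pm F(\omega)|_{L^1(\sigma)}=\int_XD_x^\pm F(\omega)\sigma(dx)$, $|D^\pm F(\omega)|_{L^1(\omega)}=\int_XD_x^\pm F(\omega)\omega(dx)$, and $|D^\pm F(\omega)|_{L^\infty(\sigma+\omega)}$ is the essential supremum with respect to $\sigma+\omega$. *)

theory Defs
  imports "HOL-Probability.Probability"
begin

text \<open>
  The metric space is the universe of the type variable. A configuration is represented by its
  set of points S, and \<open>config_measure S\<close> is the corresponding sum of Dirac measures. Under this
  identification, adding (deleting) a Dirac mass at a point outside (inside) the configuration
  is \<open>insert x\<close> (removal of x from the set).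
\<close>

definition config_measure :: "'a::metric_space set \<Rightarrow> 'a measure" where
  "config_measure S = distr (count_space S) borel (\<lambda>x. x)"

lemma space_config_measure [simp]: "space (config_measure S) = UNIV"
  and sets_config_measure [simp, measurable_cong]: "sets (config_measure S) = sets borel"
  by (simp_all add: config_measure_def)

lemma emeasure_config_measure:
  assumes "B \<in> sets borel"
  shows "emeasure (config_measure S) B = (if finite (S \<inter> B) then of_nat (card (S \<inter> B)) else \<infinity>)"
proof -
  have "emeasure (config_measure S) B = emeasure (count_space S) (S \<inter> B)"
    using assms by (simp add: config_measure_def emeasure_distr Int_commute)
  then show ?thesis
    by (simp add: emeasure_count_space)
qed

definition radon_measure :: "'a::metric_space measure \<Rightarrow> bool" where
  "radon_measure \<mu> \<longleftrightarrow> sets \<mu> = sets borel \<and>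
     (\<forall>K. compact K \<longrightarrow> emeasure \<mu> K < \<infinity>) \<and>
     (\<forall>B\<in>sets borel. emeasure \<mu> B = (SUP K\<in>{K. compact K \<and> K \<subseteq> B}. emeasure \<mu> K))"

definition configurations :: "'a::metric_space set set" where
  "configurations = {S. countable S \<and> radon_measure (config_measure S)}"

text \<open>The measurable space of configurations; its measure component is irrelevant.\<close>

definition config_algebra :: "'a::metric_space set measure" where
  "config_algebra = sigma configurations
     {{\<omega> \<in> configurations. emeasure (config_measure \<omega>) B \<in> C} | B C.
        B \<in> sets borel \<and> C \<in> sets (borel :: ennreal measure)}"

definition poisson_measure :: "'a::metric_space measure \<Rightarrow> 'a set measure \<Rightarrow> bool" where
  "poisson_measure \<sigma> \<pi> \<longleftrightarrow> prob_space \<pi> \<and> sets \<pi> = sets config_algebra \<and>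
     (\<forall>B\<in>sets borel. \<forall>k::nat.
        measure \<pi> {\<omega> \<in> space \<pi>. emeasure (config_measure \<omega>) B = of_nat k} =
        exp (- measure \<sigma> B) * measure \<sigma> B ^ k / fact k) \<and>
     (\<forall>(I :: nat set) B. finite I \<longrightarrow> (\<forall>i\<in>I. B i \<in> sets borel) \<longrightarrow> disjoint_family_on B I \<longrightarrow>
        prob_space.indep_vars \<pi> (\<lambda>_. borel) (\<lambda>i \<omega>. emeasure (config_measure \<omega>) (B i)) I)"

definition diff_op :: "('a set \<Rightarrow> real) \<Rightarrow> 'a \<Rightarrow> 'a set \<Rightarrow> real" where
  "diff_op F x \<omega> = (if x \<in> \<omega> then F \<omega> - F (\<omega> - {x}) else F \<omega> - F (insert x \<omega>))"

definition diff_plus :: "('a set \<Rightarrow> real) \<Rightarrow> 'a \<Rightarrow> 'a set \<Rightarrow> real" where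
  "diff_plus F x \<omega> = max 0 (diff_op F x \<omega>)"

definition diff_minus :: "('a set \<Rightarrow> real) \<Rightarrow> 'a \<Rightarrow> 'a set \<Rightarrow> real" where
  "diff_minus F x \<omega> = - min 0 (diff_op F x \<omega>)"

definition sum_measure :: "'a measure \<Rightarrow> 'a measure \<Rightarrow> 'a measure" where
  "sum_measure M N = measure_of (space M) (sets M) (\<lambda>A. emeasure M A + emeasure N A)"

lemma sets_sum_measure [simp, measurable_cong]: "sets (sum_measure M N) = sets M"
  and space_sum_measure [simp]: "space (sum_measure M N) = space M"
  by (simp_all add: sum_measure_def)

lemma emeasure_sum_measure:
  assumes "sets M = sets N" "A \<in> sets M"
  shows "emeasure (sum_measure M N) A = emeasure M A + emeasure N A"
  unfolding sum_measure_def
proof (rule emeasure_measure_of_sigma)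
  show "sigma_algebra (space M) (sets M)"
    by (rule sets.sigma_algebra_axioms)
  show "positive (sets M) (\<lambda>A. emeasure M A + emeasure N A)"
    by (simp add: positive_def)
  show "countably_additive (sets M) (\<lambda>A. emeasure M A + emeasure N A)"
  proof (rule countably_additiveI)
    fix B :: "nat \<Rightarrow> 'a set"
    assume B: "range B \<subseteq> sets M" "disjoint_family B"
    have "(\<Sum>i. emeasure M (B i) + emeasure N (B i)) =
        (\<Sum>i. emeasure M (B i)) + (\<Sum>i. emeasure N (B i))"
      by (intro suminf_add[symmetric] summableI)
    then show "(\<Sum>i. emeasure M (B i) + emeasure N (B i)) =
        emeasure M (\<Union> (range B)) + emeasure N (\<Union> (range B))"
      using B assms(1) by (simp add: suminf_emeasure)
  qed
qed fact

text \<open>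
  The three norms, taken for a fixed configuration \<open>\<omega>\<close>. Taking the essential supremum in
  \<open>ennreal\<close> makes it 0 (rather than minus infinity) for the null measure.
\<close>

definition norm_L1_intensity :: "'a::metric_space measure \<Rightarrow> 'a set \<Rightarrow> ('a \<Rightarrow> real) \<Rightarrow> ennreal" where
  "norm_L1_intensity \<sigma> \<omega> f = (\<integral>\<^sup>+x. ennreal \<bar>f x\<bar> \<partial>\<sigma>)"

definition norm_L1_config :: "'a::metric_space set \<Rightarrow> ('a \<Rightarrow> real) \<Rightarrow> ennreal" where
  "norm_L1_config \<omega> f = (\<integral>\<^sup>+x. ennreal \<bar>f x\<bar> \<partial>config_measure \<omega>)"

definition norm_Linf :: "'a::metric_space measure \<Rightarrow> 'a set \<Rightarrow> ('a \<Rightarrow> real) \<Rightarrow> ennreal" where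
  "norm_Linf \<sigma> \<omega> f = esssup (sum_measure \<sigma> (config_measure \<omega>)) (\<lambda>x. ennreal \<bar>f x\<bar>)"

text \<open>
  The expectation of a measurable real function makes sense, as an extended real number, when its
  positive part or its negative part has finite expectation.
\<close>

definition has_expectation :: "'b measure \<Rightarrow> ('b \<Rightarrow> real) \<Rightarrow> bool" where
  "has_expectation M f \<longleftrightarrow> f \<in> borel_measurable M \<and>
     ((\<integral>\<^sup>+x. ennreal (f x) \<partial>M) < \<infinity> \<or> (\<integral>\<^sup>+x. ennreal (- f x) \<partial>M) < \<infinity>)"

definition ext_expectation :: "'b measure \<Rightarrow> ('b \<Rightarrow> real) \<Rightarrow> ereal" where
  "ext_expectation M f =
     enn2ereal (\<integral>\<^sup>+x. ennreal (f x) \<partial>M) - enn2ereal (\<integral>\<^sup>+x. ennreal (- f x) \<partial>M)"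

definition pairing :: "('b \<Rightarrow> real) \<Rightarrow> ('b \<Rightarrow> real) \<Rightarrow> ('b \<Rightarrow> real) \<Rightarrow> 'b \<Rightarrow> real" where
  "pairing F G\<^sub>1 G\<^sub>2 \<omega> = max (F \<omega>) 0 * G\<^sub>1 \<omega> + max (- F \<omega>) 0 * G\<^sub>2 \<omega>"

definition L_defined :: "'b measure \<Rightarrow> ('b \<Rightarrow> real) set \<Rightarrow> ('b \<Rightarrow> real) \<Rightarrow> bool" where
  "L_defined M \<G> F \<longleftrightarrow> (\<forall>G\<^sub>1\<in>\<G>. \<forall>G\<^sub>2\<in>\<G>. has_expectation M (pairing F G\<^sub>1 G\<^sub>2))"

definition L_functional :: "'b measure \<Rightarrow> ('b \<Rightarrow> real) set \<Rightarrow> ('b \<Rightarrow> real) \<Rightarrow> ereal" where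
  "L_functional M \<G> F = (SUP (G\<^sub>1, G\<^sub>2)\<in>\<G> \<times> \<G>. ext_expectation M (pairing F G\<^sub>1 G\<^sub>2))"

end

theory Submission
  imports Defs
begin

text \<open>
  The non-trivial direction is a discrete co-area formula. Cut F into the layers
  \<open>1{F \<ge> i/m}\<close> and \<open>- 1{F \<le> - i/m}\<close>, \<open>1 \<le> i \<le> m\<^sup>2\<close>, whose sum divided by m is a rounding of F.
  The layers are increasing functions of F, so their one-sided differences never cancel and add up,
  after division by m, to at most the one-sided difference of F plus \<open>2/m\<close>. For each of the three
  norms the sum of the norms of the layers is therefore at most the norm for F plus \<open>2/m\<close> times a
  quantity of finite expectation, and Fatou's lemma for the pairings gives the claim as m tends to
  infinity. Working with a finite sum of layers instead of an integral over levels avoids joint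
  measurability in configuration, point and level, which may fail as X need not be separable.
\<close>

section \<open>Lower integrals of functions that need not be measurable\<close>

text \<open>
  The integrands below need not be measurable, in which case \<open>nn_integral\<close> is only a lower integral:
  it is superadditive, and subadditive if one of the summands is measurable.
\<close>

lemma nn_integral_superadditive:
  "(\<integral>\<^sup>+x. f x \<partial>M) + (\<integral>\<^sup>+x. g x \<partial>M) \<le> (\<integral>\<^sup>+x. f x + g x \<partial>M)"
proof -
  let ?S = "\<lambda>f. {s. simple_function M s \<and> s \<le> f}"
  have ne: "?S h \<noteq> {}" for h :: "'a \<Rightarrow> ennreal"
    using simple_function_const[of M 0] by (auto simp: le_fun_def intro!: exI[of _ "\<lambda>x. 0"])
  have "(\<integral>\<^sup>+x. f x \<partial>M) + (\<integral>\<^sup>+x. g x \<partial>M) =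
      (SUP t\<in>?S g. SUP s\<in>?S f. integral\<^sup>S M s + integral\<^sup>S M t)"
    unfolding nn_integral_def
    by (simp only: ennreal_SUP_add_right[OF ne] ennreal_SUP_add_left[OF ne, symmetric])
  also have "\<dots> \<le> (\<integral>\<^sup>+x. f x + g x \<partial>M)"
  proof (intro SUP_least)
    fix s t assume "s \<in> ?S f" "t \<in> ?S g"
    then have st: "simple_function M s" "simple_function M t" "\<And>x. s x \<le> f x" "\<And>x. t x \<le> g x"
      by (auto simp: le_fun_def)
    then have "integral\<^sup>S M s + integral\<^sup>S M t = (\<integral>\<^sup>+x. s x + t x \<partial>M)"
      by (simp add: nn_integral_eq_simple_integral simple_function_add)
    also have "\<dots> \<le> (\<integral>\<^sup>+x. f x + g x \<partial>M)"
      by (intro nn_integral_mono add_mono st)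
    finally show "integral\<^sup>S M s + integral\<^sup>S M t \<le> (\<integral>\<^sup>+x. f x + g x \<partial>M)" .
  qed
  finally show ?thesis .
qed

text \<open>Scaling a simple minorant of \<open>f\<close> by \<open>c\<close> gives a simple
  minorant of \<open>c * f\<close>; measurability of \<open>f\<close> does not enter.\<close>

lemma nn_integral_cmult_le: "c * (\<integral>\<^sup>+x. f x \<partial>M) \<le> (\<integral>\<^sup>+x. c * f x \<partial>M)"
proof -
  have "c * (\<integral>\<^sup>+x. f x \<partial>M) = (SUP s\<in>{s. simple_function M s \<and> s \<le> f}. c * integral\<^sup>S M s)"
    unfolding nn_integral_def by (rule SUP_mult_left_ennreal)
  also have "\<dots> \<le> (\<integral>\<^sup>+x. c * f x \<partial>M)"
  proof (intro SUP_least)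
    fix s assume "s \<in> {s. simple_function M s \<and> s \<le> f}"
    then have s: "simple_function M s" "\<And>x. s x \<le> f x"
      by (auto simp: le_fun_def)
    then have "c * integral\<^sup>S M s = (\<integral>\<^sup>+x. c * s x \<partial>M)"
      by (simp add: nn_integral_eq_simple_integral nn_integral_cmult borel_measurable_simple_function)
    also have "\<dots> \<le> (\<integral>\<^sup>+x. c * f x \<partial>M)"
      by (intro nn_integral_mono mult_left_mono s) auto
    finally show "c * integral\<^sup>S M s \<le> (\<integral>\<^sup>+x. c * f x \<partial>M)" .
  qed
  finally show ?thesis .
qed

lemma sum_nn_integral_le:
  "finite J \<Longrightarrow> (\<Sum>j\<in>J. w * (\<integral>\<^sup>+x. f j x \<partial>M)) \<le> (\<integral>\<^sup>+x. (\<Sum>j\<in>J. w * f j x) \<partial>M)"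
proof (induction J rule: finite_induct)
  case (insert j J)
  have "(\<Sum>j\<in>insert j J. w * (\<integral>\<^sup>+x. f j x \<partial>M)) \<le>
      (\<integral>\<^sup>+x. w * f j x \<partial>M) + (\<integral>\<^sup>+x. (\<Sum>j\<in>J. w * f j x) \<partial>M)"
    using insert by (simp add: add_mono nn_integral_cmult_le)
  also have "\<dots> \<le> (\<integral>\<^sup>+x. (\<Sum>j\<in>insert j J. w * f j x) \<partial>M)"
    using insert by (simp add: nn_integral_superadditive)
  finally show ?case .
qed simp

text \<open>Subtracting \<open>k\<close> from a simple minorant of \<open>f + k\<close> leaves a
  measurable minorant of \<open>f\<close>, so the integral of the minorant can be split.\<close>

lemma nn_integral_add_measurable_le:
  assumes [measurable]: "k \<in> borel_measurable M"
  shows "(\<integral>\<^sup>+x. f x + k x \<partial>M) \<le> (\<integral>\<^sup>+x. f x \<partial>M) + (\<integral>\<^sup>+x. k x \<partial>M)"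
  unfolding nn_integral_def[of M "\<lambda>x. f x + k x"]
proof (intro SUP_least)
  fix s assume "s \<in> {s. simple_function M s \<and> s \<le> (\<lambda>x. f x + k x)}"
  then have s: "simple_function M s" "\<And>x. s x \<le> f x + k x"
    by (auto simp: le_fun_def)
  have [measurable]: "s \<in> borel_measurable M"
    using s by (intro borel_measurable_simple_function)
  \<comment> \<open>In \<open>ennreal\<close>, \<open>top - top = top\<close>, which may exceed
    \<open>f x\<close>. Where \<open>k\<close> is infinite the difference is therefore set to 0, and
    \<open>k\<close> alone dominates \<open>s\<close>.\<close>
  let ?d = "\<lambda>x. if k x = top then 0 else s x - k x"
  have "integral\<^sup>S M s = (\<integral>\<^sup>+x. s x \<partial>M)"
    using s by (simp add: nn_integral_eq_simple_integral)
  also have "\<dots> \<le> (\<integral>\<^sup>+x. ?d x + k x \<partial>M)"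
  proof (rule nn_integral_mono)
    fix x show "s x \<le> ?d x + k x"
      using ennreal_minus_le_iff[of "s x" "k x" "s x - k x"] by (auto simp: add.commute)
  qed
  also have "\<dots> = (\<integral>\<^sup>+x. ?d x \<partial>M) + (\<integral>\<^sup>+x. k x \<partial>M)"
    by (intro nn_integral_add) auto
  also have "(\<integral>\<^sup>+x. ?d x \<partial>M) \<le> (\<integral>\<^sup>+x. f x \<partial>M)"
  proof (rule nn_integral_mono)
    fix x show "?d x \<le> f x"
      using s(2)[of x] by (auto simp: ennreal_minus_le_iff add.commute)
  qed
  finally show "integral\<^sup>S M s \<le> (\<integral>\<^sup>+x. f x \<partial>M) + (\<integral>\<^sup>+x. k x \<partial>M)"
    by (simp add: add_mono)
qed

section \<open>Rounding and layers of a real number\<close>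

text \<open>For \<open>m > 0\<close> this is \<open>max r 0\<close> rounded down to a multiple of
  \<open>1 / m\<close> and capped at \<open>m\<close>. The cap keeps the number of layers finite and
  disappears as \<open>m\<close> grows.\<close>

definition stair :: "nat \<Rightarrow> real \<Rightarrow> real" where
  "stair m r = (\<Sum>i=1..m^2. of_bool (real i / real m \<le> r)) / real m"

lemma stair_eq:
  assumes "m > 0"
  shows "stair m r = real (min (m^2) (nat \<lfloor>r * real m\<rfloor>)) / real m"
proof -
  have "{i\<in>{1..m^2}. real i / real m \<le> r} = {1..min (m^2) (nat \<lfloor>r * real m\<rfloor>)}"
    proof -
    have "real i / real m \<le> r \<longleftrightarrow> i \<le> nat \<lfloor>r * real m\<rfloor>" if "i \<ge> 1" for i
    proof -
      have "i \<le> nat \<lfloor>r * real m\<rfloor> \<longleftrightarrow> int i \<le> \<lfloor>r * real m\<rfloor>"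
        using that by linarith
      then show ?thesis
        using assms by (simp add: le_floor_iff field_simps)
    qed
    then show ?thesis
      by auto
  qed
  then show ?thesis
    by (simp add: stair_def sum_of_bool_eq flip: Collect_conj_eq)
      (simp add: Int_def)
qed

lemma stair_le:
  assumes "m > 0"
  shows "stair m r \<le> max r 0"
proof -
  have "real (nat \<lfloor>r * real m\<rfloor>) \<le> max r 0 * real m"
  proof (cases "r \<ge> 0")
    case False
    then have "r * real m \<le> 0"
      by (simp add: mult_nonpos_nonneg)
    then show ?thesis
      by (simp add: max_def)
  qed simp
  then have "real (min (m^2) (nat \<lfloor>r * real m\<rfloor>)) \<le> max r 0 * real m"
    by linarith
  then show ?thesis
    using assms by (simp add: stair_eq field_simps)
qed

text \<open>Below \<open>m\<close> the cap is not active, so only the rounding error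
  remains.\<close>

lemma stair_ge:
  assumes "m > 0" "r < real m"
  shows "max r 0 - 1 / real m \<le> stair m r"
proof -
  have "r * real m \<le> real m ^ 2"
    using assms by (simp add: power2_eq_square)
  moreover have "r * real m - 1 \<le> real (nat \<lfloor>r * real m\<rfloor>)"
    by linarith
  moreover have "max r 0 * real m - 1 \<le> real (nat \<lfloor>r * real m\<rfloor>)"
    using calculation by (cases "r \<ge> 0") (auto simp: max_def)
  moreover have "max r 0 * real m - 1 \<le> real m ^ 2"
    using calculation by (cases "r \<ge> 0") (auto simp: max_def intro: order_trans[of _ 0])
  ultimately have "max r 0 * real m - 1 \<le> real (min (m^2) (nat \<lfloor>r * real m\<rfloor>))"
    by (simp add: min_def)
  then have "(max r 0 * real m - 1) / real m \<le> stair m r"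
    unfolding stair_eq[OF assms(1)] by (rule divide_right_mono) simp
  then show ?thesis
    using assms by (simp add: diff_divide_distrib)
qed

text \<open>The error is \<open>1 / m\<close> uniformly in \<open>a\<close> and \<open>b\<close>,
  despite the cap: if \<open>b < m\<close>, \<open>a\<close> is rounded down and \<open>b\<close>
  loses at most \<open>1 / m\<close>; otherwise both values sit at the cap and the difference is
  0.\<close>

lemma stair_diff_le:
  assumes m: "m > 0" and ba: "b \<le> a"
  shows "stair m a - stair m b \<le> max a 0 - max b 0 + 1 / real m"
proof (cases "b < real m")
  case True
  then show ?thesis
    using stair_le[OF m, of a] stair_ge[OF m, of b] by linarith
next
  case False
  have "of_bool (real i / real m \<le> r) = (1::real)" if "i \<in> {1..m^2}" "r \<ge> b" for i r
  proof -
    have "real i \<le> real m * real m"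
      using that by (simp add: power2_eq_square flip: of_nat_mult)
    also have "\<dots> \<le> r * real m"
      using False that m by (intro mult_right_mono) auto
    finally show ?thesis
      using m by (simp add: field_simps)
  qed
  then have "stair m a = stair m b"
    using ba by (simp add: stair_def)
  then show ?thesis
    using ba by simp
qed

lemma stair_tendsto: "(\<lambda>n. stair (Suc n) r) \<longlonglongrightarrow> max r 0"
proof (rule tendsto_sandwich)
  show "\<forall>\<^sub>F n in sequentially. max r 0 - 1 / real (Suc n) \<le> stair (Suc n) r"
  proof (rule eventually_mono)
    show "\<forall>\<^sub>F n in sequentially. r < real n"
      using filterlim_real_sequentially by (auto simp: filterlim_at_top_dense)
  qed (intro stair_ge, auto)
  show "\<forall>\<^sub>F n in sequentially. stair (Suc n) r \<le> max r 0"
    by (intro always_eventually allI stair_le) auto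
  have "(\<lambda>n. max r 0 - 1 / real (Suc n)) \<longlonglongrightarrow> max r 0 - 0"
    by (intro tendsto_intros LIMSEQ_Suc lim_1_over_n)
  then show "(\<lambda>n. max r 0 - 1 / real (Suc n)) \<longlonglongrightarrow> max r 0"
    by simp
qed auto

lemma sum_Times_bool:
  "(\<Sum>j\<in>A \<times> (UNIV :: bool set). h j) = (\<Sum>i\<in>A. h (i, False) + h (i, True))"
  by (simp add: sum.cartesian_product' UNIV_bool)

text \<open>The Boolean selects the layers of the positive part or, with a minus sign, those of the
  negative part. Composed with \<open>F\<close>, each layer is thus an indicator or a negated
  indicator, as the condition on sets requires.\<close>

definition layer :: "nat \<Rightarrow> nat \<times> bool \<Rightarrow> real \<Rightarrow> real" where
  "layer m = (\<lambda>(i, p) r. if p then of_bool (real i / real m \<le> r) else - of_bool (real i / real m \<le> - r))"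

lemma mono_layer: "mono (layer m j)"
  by (cases j) (auto simp: layer_def mono_def of_bool_def)

text \<open>At most one of the two stairs is non-zero, so the layers add up to \<open>r\<close>
  rounded towards 0 and capped in absolute value.\<close>

lemma sum_layer:
  "(\<Sum>j\<in>{1..m^2} \<times> UNIV. layer m j r / real m) = stair m r - stair m (- r)"
  by (simp add: sum_Times_bool layer_def stair_def sum_subtractf sum_divide_distrib
      del: sum_of_bool_eq)

lemma sum_layer_diff_le:
  assumes m: "m > 0" and \<epsilon>: "\<epsilon> \<in> {1, -1 :: real}"
  shows "(\<Sum>j\<in>{1..m^2} \<times> UNIV. 1 / real m * max 0 (\<epsilon> * (layer m j a - layer m j b)))
    \<le> max 0 (\<epsilon> * (a - b)) + 2 / real m"
proof -
  \<comment> \<open>The case of sign 1; sign -1 is the same inequality with \<open>a\<close> and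
    \<open>b\<close> exchanged.\<close>
  have main: "(\<Sum>j\<in>{1..m^2} \<times> UNIV. 1 / real m * max 0 (layer m j a - layer m j b))
    \<le> max 0 (a - b) + 2 / real m" for a b
  proof (cases "b \<le> a")
    case True
    have "(\<Sum>j\<in>{1..m^2} \<times> UNIV. 1 / real m * max 0 (layer m j a - layer m j b)) =
        (\<Sum>j\<in>{1..m^2} \<times> UNIV. layer m j a / real m - layer m j b / real m)"
      using monoD[OF mono_layer True] by (intro sum.cong) (auto simp: max_def diff_divide_distrib)
    also have "\<dots> = (stair m a - stair m b) + (stair m (- b) - stair m (- a))"
      by (simp only: sum_subtractf sum_layer)
    also have "\<dots> \<le> (max a 0 - max b 0 + 1 / real m) + (max (- b) 0 - max (- a) 0 + 1 / real m)"
      using True by (intro add_mono stair_diff_le m) auto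
    also have "\<dots> = max 0 (a - b) + 2 / real m"
      using True by (auto simp: max_def)
    finally show ?thesis .
  next
    case False
    then have "max 0 (layer m j a - layer m j b) = 0" for j
      using monoD[OF mono_layer, of a b m j] by (auto simp: max_def)
    then show ?thesis
      by simp
  qed
  show ?thesis
    using \<epsilon> main[of a b] main[of b a] by auto
qed

text \<open>A non-zero layer forces the absolute value of \<open>r\<close> to be at least
  \<open>i / m\<close>, hence at least \<open>1 / m\<close> as \<open>i\<close> starts at 1. This
  crude domination transfers integrability from \<open>F\<close> to its layers.\<close>

lemma ennreal_layer_le:
  assumes "m > 0" "j \<in> {1..m^2} \<times> UNIV"
  shows "ennreal (layer m j r) \<le> ennreal (real m) * ennreal r"
    and "ennreal (- layer m j r) \<le> ennreal (real m) * ennreal (- r)"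
proof -
  obtain i p where j: "j = (i, p)" and i: "i \<ge> 1"
    using assms by auto
  have *: "1 \<le> real m * r" if "real i / real m \<le> r" for r
    using that assms i by (simp add: field_simps)
  show "ennreal (layer m j r) \<le> ennreal (real m) * ennreal r"
    and "ennreal (- layer m j r) \<le> ennreal (real m) * ennreal (- r)"
    using *[of r] *[of "- r"]
    by (auto simp: j layer_def of_bool_def ennreal_neg simp flip: ennreal_mult' ennreal_1 intro!: ennreal_leI)
qed

text \<open>Conversion to \<open>ennreal\<close> sends the non-positive layers to 0, so only the
  stair of the positive part survives.\<close>

lemma sum_ennreal_layer:
  "(\<Sum>j\<in>{1..m^2} \<times> UNIV. ennreal (1 / real m) * ennreal (layer m j r)) = ennreal (stair m r)"
proof -
  have "(\<Sum>j\<in>{1..m^2} \<times> UNIV. ennreal (1 / real m) * ennreal (layer m j r)) =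
      (\<Sum>i=1..m^2. ennreal (of_bool (real i / real m \<le> r) / real m))"
    by (simp add: sum_Times_bool layer_def ennreal_neg flip: ennreal_mult')
  also have "\<dots> = ennreal (stair m r)"
    by (subst sum_ennreal) (auto simp: stair_def sum_divide_distrib simp del: sum_of_bool_eq)
  finally show ?thesis .
qed

lemma sum_ennreal_layer_uminus:
  "(\<Sum>j\<in>{1..m^2} \<times> UNIV. ennreal (1 / real m) * ennreal (- layer m j r)) = ennreal (stair m (- r))"
proof -
  have "(\<Sum>j\<in>{1..m^2} \<times> UNIV. ennreal (1 / real m) * ennreal (- layer m j r)) =
      (\<Sum>i=1..m^2. ennreal (of_bool (real i / real m \<le> - r) / real m))"
    by (simp add: sum_Times_bool layer_def ennreal_neg flip: ennreal_mult')
  also have "\<dots> = ennreal (stair m (- r))"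
    by (subst sum_ennreal) (auto simp: stair_def sum_divide_distrib simp del: sum_of_bool_eq)
  finally show ?thesis .
qed

lemma measurable_layer [measurable]: "layer m j \<in> borel_measurable borel"
  by (intro borel_measurable_mono mono_layer)

lemma measurable_stair [measurable]: "stair m \<in> borel_measurable borel"
proof -
  have "mono (stair m)"
    unfolding stair_def mono_def by (intro allI impI divide_right_mono sum_mono) (auto simp: of_bool_def)
  then show ?thesis
    by (rule borel_measurable_mono)
qed

section \<open>Norms of the increments of the layers\<close>

text \<open>Here \<open>a\<close> stands for the value of \<open>F\<close> at a configuration and
  \<open>h x\<close> for its value after a change at \<open>x\<close>. Integrating the pointwise
  bound turns the slack \<open>2 * w\<close> into \<open>2 * w\<close> times the total mass;
  superadditivity of lower integrals copes with arbitrary \<open>h\<close>.\<close>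

lemma L1_layers_le:
  fixes h :: "'a \<Rightarrow> real" and s :: "'j \<Rightarrow> real \<Rightarrow> real"
  assumes J: "finite J" and w: "w \<ge> 0"
    and s: "\<And>a b. (\<Sum>j\<in>J. w * max 0 (\<epsilon> * (s j a - s j b))) \<le> max 0 (\<epsilon> * (a - b)) + 2 * w"
  shows "(\<Sum>j\<in>J. ennreal w * (\<integral>\<^sup>+x. ennreal \<bar>max 0 (\<epsilon> * (s j a - s j (h x)))\<bar> \<partial>M))
    \<le> (\<integral>\<^sup>+x. ennreal \<bar>max 0 (\<epsilon> * (a - h x))\<bar> \<partial>M) + ennreal (2 * w) * emeasure M (space M)"
proof -
  have "(\<Sum>j\<in>J. ennreal w * (\<integral>\<^sup>+x. ennreal \<bar>max 0 (\<epsilon> * (s j a - s j (h x)))\<bar> \<partial>M))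
      \<le> (\<integral>\<^sup>+x. (\<Sum>j\<in>J. ennreal w * ennreal \<bar>max 0 (\<epsilon> * (s j a - s j (h x)))\<bar>) \<partial>M)"
    by (rule sum_nn_integral_le[OF J])
  also have "\<dots> \<le> (\<integral>\<^sup>+x. ennreal \<bar>max 0 (\<epsilon> * (a - h x))\<bar> + ennreal (2 * w) \<partial>M)"
  proof (rule nn_integral_mono)
    fix x
    have "(\<Sum>j\<in>J. ennreal w * ennreal \<bar>max 0 (\<epsilon> * (s j a - s j (h x)))\<bar>)
        = ennreal (\<Sum>j\<in>J. w * max 0 (\<epsilon> * (s j a - s j (h x))))"
      using w by (subst sum_ennreal[symmetric]) (auto simp: abs_of_nonneg ennreal_mult simp del: ennreal_max_0)
    also have "\<dots> \<le> ennreal (max 0 (\<epsilon> * (a - h x)) + 2 * w)"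
      by (intro ennreal_leI s)
    finally show "(\<Sum>j\<in>J. ennreal w * ennreal \<bar>max 0 (\<epsilon> * (s j a - s j (h x)))\<bar>)
        \<le> ennreal \<bar>max 0 (\<epsilon> * (a - h x))\<bar> + ennreal (2 * w)"
      using w by (simp add: ennreal_plus)
  qed
  also have "\<dots> \<le> (\<integral>\<^sup>+x. ennreal \<bar>max 0 (\<epsilon> * (a - h x))\<bar> \<partial>M) + (\<integral>\<^sup>+x. ennreal (2 * w) \<partial>M)"
    by (rule nn_integral_add_measurable_le) simp
  finally show ?thesis
    by simp
qed

text \<open>Essential suprema are in general only subadditive, which is the wrong direction. Here
  all summands are increasing functions of one quantity, so all of them are controlled at its
  essential supremum \<open>e\<close>, and the pointwise bound applies at that single value.\<close>

lemma esssup_layers_le: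
  fixes h :: "'a \<Rightarrow> real" and s :: "'j \<Rightarrow> real \<Rightarrow> real"
  assumes J: "finite J" and w: "w \<ge> 0" and \<epsilon>: "\<epsilon> \<in> {1, -1}"
    and mono: "\<And>j. j \<in> J \<Longrightarrow> mono (s j)"
    and s: "\<And>a b. (\<Sum>j\<in>J. w * max 0 (\<epsilon> * (s j a - s j b))) \<le> max 0 (\<epsilon> * (a - b)) + 2 * w"
  shows "(\<Sum>j\<in>J. ennreal w * esssup M (\<lambda>x. ennreal \<bar>max 0 (\<epsilon> * (s j a - s j (h x)))\<bar>))
    \<le> esssup M (\<lambda>x. ennreal \<bar>max 0 (\<epsilon> * (a - h x))\<bar>) + ennreal (2 * w)"
proof (cases "esssup M (\<lambda>x. ennreal \<bar>max 0 (\<epsilon> * (a - h x))\<bar>) = top")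
  case False
  define z where "z x = max 0 (\<epsilon> * (a - h x))" for x
  obtain e where e: "e \<ge> 0" "esssup M (\<lambda>x. ennreal \<bar>max 0 (\<epsilon> * (a - h x))\<bar>) = ennreal e"
    using False by (cases "esssup M (\<lambda>x. ennreal \<bar>max 0 (\<epsilon> * (a - h x))\<bar>)") auto
  \<comment> \<open>By convention \<open>esssup\<close> is \<open>top\<close> for a non-measurable
    function, so a finite value yields measurability.\<close>
  have "(\<lambda>x. ennreal \<bar>max 0 (\<epsilon> * (a - h x))\<bar>) \<in> borel_measurable M"
    using False esssup_non_measurable by blast
  then have "(\<lambda>x. enn2real (ennreal \<bar>max 0 (\<epsilon> * (a - h x))\<bar>)) \<in> borel_measurable M"
    by (rule measurable_compose) simp
  then have z[measurable]: "z \<in> borel_measurable M"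
    by (simp add: z_def[abs_def] del: ennreal_max_0)
  have "AE x in M. ennreal \<bar>max 0 (\<epsilon> * (a - h x))\<bar> \<le> ennreal e"
    unfolding e(2)[symmetric] by (rule esssup_AE)
  then have ze: "AE x in M. z x \<le> e"
    using e(1) by (auto simp: z_def ennreal_le_iff elim!: eventually_mono)
  \<comment> \<open>By monotonicity, the increment of a layer is a monotone function of the increment z of the
    identity, so it inherits measurability and the almost sure bound.\<close>
  define t where "t j y = max 0 (\<epsilon> * (s j a - s j (a - \<epsilon> * y)))" for j y
  have t: "max 0 (\<epsilon> * (s j a - s j (h x))) = t j (z x)" and mono_t: "mono (t j)" if "j \<in> J" for j x
  proof -
    have m: "s j u \<le> s j v" if "u \<le> v" for u v
      using mono[OF \<open>j \<in> J\<close>] that by (rule monoD)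
    \<comment> \<open>If the signed increment of the identity is negative, monotonicity makes that
      of the layer non-positive, and both sides are 0.\<close>
    show "max 0 (\<epsilon> * (s j a - s j (h x))) = t j (z x)"
      using \<epsilon> m[of a "h x"] m[of "h x" a] by (cases "h x \<le> a") (auto simp: t_def z_def max_def)
    show "mono (t j)"
      unfolding mono_def t_def
    proof (intro allI impI max.mono order_refl)
      fix x y :: real assume "x \<le> y"
      then show "\<epsilon> * (s j a - s j (a - \<epsilon> * x)) \<le> \<epsilon> * (s j a - s j (a - \<epsilon> * y))"
        using \<epsilon> m[of "a - y" "a - x"] m[of "a + x" "a + y"] by auto
    qed
  qed
  have "(\<Sum>j\<in>J. ennreal w * esssup M (\<lambda>x. ennreal \<bar>max 0 (\<epsilon> * (s j a - s j (h x)))\<bar>))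
      \<le> (\<Sum>j\<in>J. ennreal w * ennreal (t j e))"
  proof (intro sum_mono mult_left_mono)
    fix j assume j: "j \<in> J"
    have [measurable]: "t j \<in> borel_measurable borel"
      by (intro borel_measurable_mono mono_t j)
    have "esssup M (\<lambda>x. ennreal \<bar>t j (z x)\<bar>) \<le> ennreal (t j e)"
    proof (rule esssup_I)
      show "AE x in M. ennreal \<bar>t j (z x)\<bar> \<le> ennreal (t j e)"
        using ze
      proof eventually_elim
        case (elim x)
        have "t j (z x) \<le> t j e"
          using mono_t[OF j] elim by (rule monoD)
        moreover have "0 \<le> t j (z x)"
          by (simp add: t_def)
        ultimately show ?case
          by (simp add: ennreal_leI)
      qed
    qed measurable
    then show "esssup M (\<lambda>x. ennreal \<bar>max 0 (\<epsilon> * (s j a - s j (h x)))\<bar>) \<le> ennreal (t j e)"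
      by (simp only: t[OF j])
  qed simp
  also have "\<dots> = ennreal (\<Sum>j\<in>J. w * max 0 (\<epsilon> * (s j a - s j (a - \<epsilon> * e))))"
    using w by (subst sum_ennreal[symmetric]) (auto simp: t_def ennreal_mult simp del: ennreal_max_0)
  \<comment> \<open>The pointwise bound is used at \<open>b = a - \<epsilon> * e\<close>, whose
    signed increment is \<open>e\<close> since the square of \<epsilon> is 1.\<close>
  also have "\<dots> \<le> ennreal (max 0 (\<epsilon> * (a - (a - \<epsilon> * e))) + 2 * w)"
    by (intro ennreal_leI s)
  also have "\<dots> = ennreal e + ennreal (2 * w)"
    using e(1) \<epsilon> w by (auto simp: ennreal_plus)
  finally show ?thesis
    unfolding e(2) .
qed simp

section \<open>Finite configurations and the Poisson number of points\<close>

text \<open>Inner regularity is attained at the finite, hence compact, set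
  \<open>S \<inter> B\<close>. This keeps a finite configuration in the space when a point is added
  or removed.\<close>

lemma finite_in_configurations:
  assumes "finite S"
  shows "S \<in> configurations"
proof -
  have "emeasure (config_measure S) B = (SUP K\<in>{K. compact K \<and> K \<subseteq> B}. emeasure (config_measure S) K)"
    if B: "B \<in> sets borel" for B
  proof (rule antisym)
    have "emeasure (config_measure S) B = emeasure (config_measure S) (S \<inter> B)"
      using assms B by (simp add: emeasure_config_measure finite_imp_closed borel_closed)
    also have "\<dots> \<le> (SUP K\<in>{K. compact K \<and> K \<subseteq> B}. emeasure (config_measure S) K)"
      using assms by (intro SUP_upper) (auto intro: finite_imp_compact)
    finally show "emeasure (config_measure S) B \<le> \<dots>" .
    show "(SUP K\<in>{K. compact K \<and> K \<subseteq> B}. emeasure (config_measure S) K) \<le> emeasure (config_measure S) B"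
      using B by (intro SUP_least emeasure_mono) auto
  qed
  moreover have "emeasure (config_measure S) K < \<infinity>" if "compact K" for K
    using assms that
    by (simp add: emeasure_config_measure borel_closed compact_imp_closed of_nat_less_top)
  ultimately show ?thesis
    using assms by (simp add: configurations_def radon_measure_def countable_finite)
qed

lemma space_config_algebra: "space config_algebra = configurations"
  unfolding config_algebra_def by (rule space_measure_of) auto

lemma measurable_emeasure_config_measure:
  assumes "B \<in> sets borel"
  shows "(\<lambda>\<omega>. emeasure (config_measure \<omega>) B) \<in> borel_measurable config_algebra"
proof (rule measurableI)
  fix C :: "ennreal set" assume "C \<in> sets borel"
  then have "{\<omega> \<in> configurations. emeasure (config_measure \<omega>) B \<in> C} \<in> sets config_algebra"
    using assms unfolding config_algebra_def
    by (subst sets_measure_of) (auto intro!: sigma_sets.Basic)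
  then show "(\<lambda>\<omega>. emeasure (config_measure \<omega>) B) -` C \<inter> space config_algebra \<in> sets config_algebra"
    by (simp add: space_config_algebra vimage_def Int_def conj_commute)
qed simp

text \<open>The total number of points has a Poisson law. Its probabilities at the natural numbers
  add up to 1, which excludes infinitely many points almost surely, and its mean is a convergent
  series.\<close>

lemma poisson_total_mass:
  assumes "poisson_measure \<sigma> \<pi>"
  shows "AE \<omega> in \<pi>. finite \<omega>"
    and "(\<integral>\<^sup>+\<omega>. emeasure (config_measure \<omega>) UNIV \<partial>\<pi>) < \<infinity>"
proof -
  interpret prob_space \<pi>
    using assms by (simp add: poisson_measure_def)
  define N where "N \<omega> = emeasure (config_measure \<omega>) UNIV" for \<omega> :: "'a set"
  define A where "A k = {\<omega> \<in> space \<pi>. N \<omega> = of_nat k}" for k :: nat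
  define s where "s = measure \<sigma> UNIV"
  have sets: "sets \<pi> = sets config_algebra"
    using assms by (simp add: poisson_measure_def)
  have N[measurable]: "N \<in> borel_measurable \<pi>"
    using measurable_emeasure_config_measure[of UNIV]
    by (simp add: N_def[abs_def] measurable_cong_sets[OF sets refl])
  have A[measurable]: "A k \<in> sets \<pi>" for k
    unfolding A_def by measurable
  have pA: "measure \<pi> (A k) = exp (- s) * s ^ k / fact k" for k
    using assms by (simp add: poisson_measure_def A_def N_def s_def)
  have "s \<ge> 0"
    by (simp add: s_def)
  have "(\<lambda>k. measure \<pi> (A k)) sums measure \<pi> (\<Union>k. A k)"
    by (intro finite_measure_UNION) (auto simp: disjoint_family_on_def A_def)
  moreover have "(\<lambda>k. measure \<pi> (A k)) sums 1"
  proof -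
    have "(\<lambda>k. exp (- s) * (s ^ k /\<^sub>R fact k)) sums (exp (- s) * exp s)"
      by (intro sums_mult exp_converges)
    then show ?thesis
      by (simp add: pA exp_minus field_simps)
  qed
  ultimately have "prob (\<Union>k. A k) = 1"
    by (rule sums_unique2)
  then have AE_A: "AE \<omega> in \<pi>. \<omega> \<in> (\<Union>k. A k)"
    by (rule AE_prob_1)
  then show "AE \<omega> in \<pi>. finite \<omega>"
  proof eventually_elim
    case (elim \<omega>)
    then have "N \<omega> \<noteq> \<infinity>"
      by (auto simp: A_def)
    then show ?case
      by (auto simp: N_def emeasure_config_measure split: if_splits)
  qed
  have "(\<integral>\<^sup>+\<omega>. N \<omega> \<partial>\<pi>) = (\<integral>\<^sup>+\<omega>. (\<Sum>k. of_nat k * indicator (A k) \<omega>) \<partial>\<pi>)"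
  proof (rule nn_integral_cong_AE, use AE_A in eventually_elim)
    case (elim \<omega>)
    then obtain n where n: "\<omega> \<in> A n"
      by auto
    then have "\<omega> \<in> A k \<longleftrightarrow> k = n" for k
      by (auto simp: A_def)
    then have "(\<Sum>k. of_nat k * indicator (A k) \<omega> :: ennreal) = (\<Sum>k\<in>{n}. of_nat k * indicator (A k) \<omega>)"
      by (intro suminf_finite) auto
    also have "\<dots> = N \<omega>"
      using n by simp (simp add: A_def)
    finally show ?case ..
  qed
  also have "\<dots> = (\<Sum>k. of_nat k * emeasure \<pi> (A k))"
    by (simp add: nn_integral_suminf nn_integral_cmult)
  also have "\<dots> = (\<Sum>k. ennreal (real k * (exp (- s) * s ^ k / fact k)))"
    unfolding emeasure_eq_measure pA
    by (intro suminf_cong) (simp only: ennreal_of_nat_eq_real_of_nat ennreal_mult'[OF of_nat_0_le_iff])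
  also have "\<dots> \<noteq> top"
  proof (rule ennreal_suminf_neq_top)
    show "summable (\<lambda>k. real k * (exp (- s) * s ^ k / fact k))"
    proof (rule summable_comparison_test')
      \<comment> \<open>Bounding the factor \<open>k\<close> by \<open>2 ^ k\<close> leads to the
        exponential series at \<open>2 * s\<close>; only finiteness of the mean is at stake.\<close>
      show "summable (\<lambda>k. exp (- s) * ((2 * s) ^ k /\<^sub>R fact k))"
        by (intro summable_mult summable_exp_generic)
      fix k
      have "real k \<le> 2 ^ k"
        by (simp add: of_nat_less_two_power less_imp_le)
      then have "real k * (exp (- s) * s ^ k / fact k) \<le> 2 ^ k * (exp (- s) * s ^ k / fact k)"
        using \<open>s \<ge> 0\<close> by (intro mult_right_mono) auto
      then show "norm (real k * (exp (- s) * s ^ k / fact k)) \<le> exp (- s) * ((2 * s) ^ k /\<^sub>R fact k)"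
        using \<open>s \<ge> 0\<close> by (simp add: power_mult_distrib field_simps)
    qed
  qed (use \<open>s \<ge> 0\<close> in auto)
  finally show "(\<integral>\<^sup>+\<omega>. emeasure (config_measure \<omega>) UNIV \<partial>\<pi>) < \<infinity>"
    by (simp add: N_def less_top)
qed

section \<open>The functional inequality without subtraction\<close>

text \<open>Moving the negative part to the right gives an inequality of sums in
  \<open>ennreal\<close>, which can be added over layers and passed to the limit. Finiteness of one
  part rules out the difference of two infinities.\<close>

lemma ereal_diff_le_iff_ennreal:
  assumes "c \<ge> 0" and "P < top \<or> N < top"
  shows "ereal c * (enn2ereal P - enn2ereal N) \<le> enn2ereal R \<longleftrightarrow>
    ennreal c * P \<le> R + ennreal c * N"
proof (cases "c = 0")
  case False
  with assms have "c > 0"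
    by simp
  then show ?thesis
    using assms
    by (cases P; cases N; cases R)
      (auto simp: ennreal_mult_top ennreal_mult_less_top ennreal_top_mult enn2ereal_ennreal top_unique
        simp flip: ennreal_mult' ennreal_plus simp: ennreal_le_iff algebra_simps)
qed (simp flip: zero_ereal_def)

text \<open>Since \<open>c\<close> is non-negative it moves inside the supremum, which reduces the
  claim to one fixed pair \<open>G\<^sub>1\<close>, \<open>G\<^sub>2\<close> at a time.\<close>

lemma L_functional_le_iff:
  assumes "c \<ge> 0" and "\<G> \<noteq> {}" and "L_defined M \<G> F"
  shows "ereal c * L_functional M \<G> F \<le> enn2ereal R \<longleftrightarrow>
    (\<forall>G\<^sub>1\<in>\<G>. \<forall>G\<^sub>2\<in>\<G>. ennreal c * (\<integral>\<^sup>+\<omega>. ennreal (pairing F G\<^sub>1 G\<^sub>2 \<omega>) \<partial>M)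
      \<le> R + ennreal c * (\<integral>\<^sup>+\<omega>. ennreal (- pairing F G\<^sub>1 G\<^sub>2 \<omega>) \<partial>M))"
proof -
  have "ereal c * L_functional M \<G> F =
      (SUP p\<in>\<G> \<times> \<G>. ereal c * ext_expectation M (pairing F (fst p) (snd p)))"
    unfolding L_functional_def case_prod_unfold
    using assms by (intro Sup_ereal_mult_left') auto
  then have "ereal c * L_functional M \<G> F \<le> enn2ereal R \<longleftrightarrow>
      (\<forall>G\<^sub>1\<in>\<G>. \<forall>G\<^sub>2\<in>\<G>. ereal c * ext_expectation M (pairing F G\<^sub>1 G\<^sub>2) \<le> enn2ereal R)"
    by (auto simp: SUP_le_iff)
  also have "\<dots> \<longleftrightarrow> (\<forall>G\<^sub>1\<in>\<G>. \<forall>G\<^sub>2\<in>\<G>. ennreal c * (\<integral>\<^sup>+\<omega>. ennreal (pairing F G\<^sub>1 G\<^sub>2 \<omega>) \<partial>M)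
      \<le> R + ennreal c * (\<integral>\<^sup>+\<omega>. ennreal (- pairing F G\<^sub>1 G\<^sub>2 \<omega>) \<partial>M))"
    using assms
    by (intro ball_cong refl)
      (auto simp: ext_expectation_def L_defined_def has_expectation_def ereal_diff_le_iff_ennreal)
  finally show ?thesis .
qed

text \<open>Positive and negative parts of \<open>F\<close> are never both non-zero, so truncation
  at 0 acts on each product separately.\<close>

lemma ennreal_pairing:
  "ennreal (pairing F G\<^sub>1 G\<^sub>2 \<omega>) = ennreal (F \<omega>) * ennreal (G\<^sub>1 \<omega>) + ennreal (- F \<omega>) * ennreal (G\<^sub>2 \<omega>)"
  using ennreal_mult'[of "F \<omega>" "G\<^sub>1 \<omega>"] ennreal_mult'[of "- F \<omega>" "G\<^sub>2 \<omega>"]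
  by (cases "F \<omega> \<ge> 0") (auto simp: pairing_def max_def ennreal_neg)

lemma ennreal_uminus_pairing:
  "ennreal (- pairing F G\<^sub>1 G\<^sub>2 \<omega>) = ennreal (F \<omega>) * ennreal (- G\<^sub>1 \<omega>) + ennreal (- F \<omega>) * ennreal (- G\<^sub>2 \<omega>)"
  using ennreal_pairing[of F "\<lambda>\<omega>. - G\<^sub>1 \<omega>" "\<lambda>\<omega>. - G\<^sub>2 \<omega>" \<omega>] by (simp add: pairing_def)

section \<open>The co-area inequality for the difference operators\<close>

text \<open>One error term serves all three norms: the slack is multiplied by the mass of \<sigma>,
  by the mass of \<omega>, or by 1 for the essential supremum, and the sum dominates each.\<close>

lemma norm_layers_le:
  fixes h :: "'a::metric_space \<Rightarrow> real" and s :: "'j \<Rightarrow> real \<Rightarrow> real"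
  assumes \<sigma>: "sets \<sigma> = sets borel"
    and nrm: "nrm \<in> {norm_L1_intensity \<sigma>, norm_L1_config, norm_Linf \<sigma>}"
    and J: "finite J" and w: "w \<ge> 0" and \<epsilon>: "\<epsilon> \<in> {1, -1}"
    and mono: "\<And>j. j \<in> J \<Longrightarrow> mono (s j)"
    and s: "\<And>a b. (\<Sum>j\<in>J. w * max 0 (\<epsilon> * (s j a - s j b))) \<le> max 0 (\<epsilon> * (a - b)) + 2 * w"
  shows "(\<Sum>j\<in>J. ennreal w * nrm \<omega> (\<lambda>x. max 0 (\<epsilon> * (s j a - s j (h x)))))
    \<le> nrm \<omega> (\<lambda>x. max 0 (\<epsilon> * (a - h x)))
      + ennreal (2 * w) * (emeasure \<sigma> UNIV + emeasure (config_measure \<omega>) UNIV + 1)"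
    (is "?lhs \<le> ?n + ennreal (2 * w) * ?K")
proof -
  have "space \<sigma> = UNIV"
    using sets_eq_imp_space_eq[OF \<sigma>] by simp
  then consider "?lhs \<le> ?n + ennreal (2 * w) * emeasure \<sigma> UNIV"
    | "?lhs \<le> ?n + ennreal (2 * w) * emeasure (config_measure \<omega>) UNIV"
    | "?lhs \<le> ?n + ennreal (2 * w) * 1"
    using nrm L1_layers_le[OF J w s, where a = a and h = h and M = \<sigma>]
      L1_layers_le[OF J w s, where a = a and h = h and M = "config_measure \<omega>"]
      esssup_layers_le[OF J w \<epsilon> mono s, where a = a and h = h and M = "sum_measure \<sigma> (config_measure \<omega>)"]
    unfolding norm_L1_intensity_def norm_L1_config_def norm_Linf_def by fastforce
  then show ?thesis
  proof cases
    case 1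
    moreover have "emeasure \<sigma> UNIV \<le> ?K"
      by (simp add: add.assoc)
    ultimately show ?thesis
      by (meson add_left_mono mult_left_mono order_trans zero_le)
  next
    case 2
    moreover have "emeasure (config_measure \<omega>) UNIV \<le> ?K"
      by (simp add: add.assoc add.left_commute[of "emeasure \<sigma> UNIV"])
    ultimately show ?thesis
      by (meson add_left_mono mult_left_mono order_trans zero_le)
  next
    case 3
    moreover have "1 \<le> ?K"
      by (simp add: add.commute)
    ultimately show ?thesis
      by (meson add_left_mono mult_left_mono order_trans zero_le)
  qed
qed

text \<open>Toggling a point merges the two cases of \<open>diff_op\<close> into one
  formula.\<close>

definition flip :: "'a \<Rightarrow> 'a set \<Rightarrow> 'a set" where
  "flip x \<omega> = (if x \<in> \<omega> then \<omega> - {x} else insert x \<omega>)"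

text \<open>As \<open>- min 0 d = max 0 (- d)\<close>, a sign \<epsilon> treats both operators at
  once.\<close>

lemma diff_eq_flip:
  assumes "D \<in> {diff_plus, diff_minus}"
  obtains \<epsilon> :: real where "\<epsilon> \<in> {1, -1}"
    and "\<And>F x \<omega>. D F x \<omega> = max 0 (\<epsilon> * (F \<omega> - F (flip x \<omega>)))"
proof (cases "D = diff_plus")
  case True
  then show ?thesis
    by (intro that[of 1]) (auto simp: diff_plus_def diff_op_def flip_def)
next
  case False
  then have "D = diff_minus"
    using assms by auto
  then show ?thesis
    by (intro that[of "-1"]) (auto simp: diff_minus_def diff_op_def flip_def max_def min_def)
qed

text \<open>\<open>H j\<close> is prescribed only on the space because an indicator of a subset of
  the space vanishes outside it, whereas the layer of \<open>F\<close> need not.\<close>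

lemma sum_norm_diff_layers_le:
  fixes \<sigma> :: "'a::metric_space measure"
  assumes \<sigma>: "sets \<sigma> = sets borel" and \<pi>: "poisson_measure \<sigma> \<pi>"
    and nrm: "nrm \<in> {norm_L1_intensity \<sigma>, norm_L1_config, norm_Linf \<sigma>}"
    and D: "D \<in> {diff_plus, diff_minus}"
    and m: "m > 0"
    and H: "\<And>j \<omega>. j \<in> {1..m^2} \<times> UNIV \<Longrightarrow> \<omega> \<in> space \<pi> \<Longrightarrow> H j \<omega> = layer m j (F \<omega>)"
  shows "(\<Sum>j\<in>{1..m^2} \<times> UNIV. ennreal (1 / real m) * (\<integral>\<^sup>+\<omega>. nrm \<omega> (\<lambda>x. D (H j) x \<omega>) \<partial>\<pi>))
    \<le> (\<integral>\<^sup>+\<omega>. nrm \<omega> (\<lambda>x. D F x \<omega>) \<partial>\<pi>) + ennreal (2 / real m) *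
        (\<integral>\<^sup>+\<omega>. emeasure \<sigma> UNIV + emeasure (config_measure \<omega>) UNIV + 1 \<partial>\<pi>)"
proof -
  define K where "K \<omega> = emeasure \<sigma> UNIV + emeasure (config_measure \<omega>) UNIV + 1" for \<omega> :: "'a set"
  let ?J = "{1..m^2} \<times> (UNIV :: bool set)"
  obtain \<epsilon> :: real where \<epsilon>: "\<epsilon> \<in> {1, -1}"
    and D_eq: "\<And>F x \<omega>. D F x \<omega> = max 0 (\<epsilon> * (F \<omega> - F (flip x \<omega>)))"
    using diff_eq_flip[OF D] by metis
  have sets: "sets \<pi> = sets config_algebra"
    using \<pi> by (simp add: poisson_measure_def)
  have space: "space \<pi> = configurations"
    using sets_eq_imp_space_eq[OF sets] by (simp add: space_config_algebra)
  have "(\<lambda>\<omega>. emeasure (config_measure \<omega>) UNIV) \<in> borel_measurable \<pi>"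
    using measurable_emeasure_config_measure[of UNIV] by (simp add: measurable_cong_sets[OF sets refl])
  then have K[measurable]: "K \<in> borel_measurable \<pi>"
    unfolding K_def[abs_def] by measurable
  have "(\<Sum>j\<in>?J. ennreal (1 / real m) * (\<integral>\<^sup>+\<omega>. nrm \<omega> (\<lambda>x. D (H j) x \<omega>) \<partial>\<pi>))
      \<le> (\<integral>\<^sup>+\<omega>. (\<Sum>j\<in>?J. ennreal (1 / real m) * nrm \<omega> (\<lambda>x. D (H j) x \<omega>)) \<partial>\<pi>)"
    by (intro sum_nn_integral_le) auto
  also have "\<dots> \<le> (\<integral>\<^sup>+\<omega>. nrm \<omega> (\<lambda>x. D F x \<omega>) + ennreal (2 / real m) * K \<omega> \<partial>\<pi>)"
  proof (rule nn_integral_mono_AE, use poisson_total_mass(1)[OF \<pi>] in eventually_elim)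
    case (elim \<omega>)
    \<comment> \<open>Finiteness keeps the flipped configuration in the space, where H j is a layer of F.\<close>
    have conf: "\<omega> \<in> space \<pi>" "flip x \<omega> \<in> space \<pi>" for x
      using elim by (auto simp: space flip_def finite_in_configurations)
    have "(\<Sum>j\<in>?J. ennreal (1 / real m) * nrm \<omega> (\<lambda>x. D (H j) x \<omega>)) =
        (\<Sum>j\<in>?J. ennreal (1 / real m) *
          nrm \<omega> (\<lambda>x. max 0 (\<epsilon> * (layer m j (F \<omega>) - layer m j (F (flip x \<omega>))))))"
      by (intro sum.cong refl) (simp add: D_eq H conf)
    also have "\<dots> \<le> nrm \<omega> (\<lambda>x. max 0 (\<epsilon> * (F \<omega> - F (flip x \<omega>)))) + ennreal (2 * (1 / real m)) * K \<omega>"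
      unfolding K_def
    proof (rule norm_layers_le[OF \<sigma> nrm _ _ \<epsilon> mono_layer])
      show "(\<Sum>j\<in>?J. 1 / real m * max 0 (\<epsilon> * (layer m j a - layer m j b)))
          \<le> max 0 (\<epsilon> * (a - b)) + 2 * (1 / real m)" for a b
        using sum_layer_diff_le[OF m \<epsilon>, of a b] by simp
    qed auto
    finally show ?case
      by (simp add: D_eq)
  qed
  \<comment> \<open>The norm may fail to be measurable in \<omega>, but \<open>K\<close> is
    measurable, which suffices for splitting in this direction.\<close>
  also have "\<dots> \<le> (\<integral>\<^sup>+\<omega>. nrm \<omega> (\<lambda>x. D F x \<omega>) \<partial>\<pi>) + (\<integral>\<^sup>+\<omega>. ennreal (2 / real m) * K \<omega> \<partial>\<pi>)"
    by (intro nn_integral_add_measurable_le) measurable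
  also have "(\<integral>\<^sup>+\<omega>. ennreal (2 / real m) * K \<omega> \<partial>\<pi>) = ennreal (2 / real m) * (\<integral>\<^sup>+\<omega>. K \<omega> \<partial>\<pi>)"
    by (intro nn_integral_cmult) measurable
  finally show ?thesis
    unfolding K_def .
qed

section \<open>Pairings of the layers\<close>

lemma sum_nn_integral_layers:
  assumes [measurable]: "F \<in> borel_measurable M" "G\<^sub>1 \<in> borel_measurable M" "G\<^sub>2 \<in> borel_measurable M"
  shows "(\<Sum>j\<in>{1..m^2} \<times> UNIV. ennreal (1 / real m) *
      (\<integral>\<^sup>+\<omega>. ennreal (layer m j (F \<omega>)) * ennreal (G\<^sub>1 \<omega>) + ennreal (- layer m j (F \<omega>)) * ennreal (G\<^sub>2 \<omega>) \<partial>M))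
    = (\<integral>\<^sup>+\<omega>. ennreal (stair m (F \<omega>)) * ennreal (G\<^sub>1 \<omega>) + ennreal (stair m (- F \<omega>)) * ennreal (G\<^sub>2 \<omega>) \<partial>M)"
    (is "?lhs = _")
proof -
  have "?lhs = (\<integral>\<^sup>+\<omega>. (\<Sum>j\<in>{1..m^2} \<times> UNIV. ennreal (1 / real m) * ennreal (layer m j (F \<omega>))) * ennreal (G\<^sub>1 \<omega>)
      + (\<Sum>j\<in>{1..m^2} \<times> UNIV. ennreal (1 / real m) * ennreal (- layer m j (F \<omega>))) * ennreal (G\<^sub>2 \<omega>) \<partial>M)"
    by (simp add: nn_integral_sum[symmetric] nn_integral_cmult[symmetric] sum_distrib_left sum_distrib_right
        sum.distrib[symmetric] distrib_left mult.assoc del: sum_ennreal)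
  then show ?thesis
    by (simp only: sum_ennreal_layer sum_ennreal_layer_uminus)
qed

lemma tendsto_stair_pairing:
  "(\<lambda>n. ennreal (stair (Suc n) (F \<omega>)) * ennreal (G\<^sub>1 \<omega>) + ennreal (stair (Suc n) (- F \<omega>)) * ennreal (G\<^sub>2 \<omega>))
    \<longlonglongrightarrow> ennreal (F \<omega>) * ennreal (G\<^sub>1 \<omega>) + ennreal (- F \<omega>) * ennreal (G\<^sub>2 \<omega>)"
proof -
  have "(\<lambda>n. ennreal (stair (Suc n) r)) \<longlonglongrightarrow> ennreal r" for r
    using tendsto_ennrealI[OF stair_tendsto[of r]] by (simp add: max.commute)
  then show ?thesis
    \<comment> \<open>The fixed factors are moved to the left; being finite, they make the
      multiplication continuous.\<close>
    by (subst (1 2 3 4) mult.commute) (intro tendsto_add ennreal_tendsto_cmult; simp)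
qed

text \<open>The condition on sets applies only where the functional is defined. Each part of a
  layer's pairing is at most \<open>m\<close> times the same part for \<open>F\<close>, so whichever
  part is finite for \<open>F\<close> stays finite.\<close>

lemma L_defined_layer:
  assumes F[measurable]: "F \<in> borel_measurable M" and G: "\<G> \<subseteq> borel_measurable M"
    and L: "L_defined M \<G> F"
    and m: "m > 0" "j \<in> {1..m^2} \<times> UNIV"
    and H: "\<And>\<omega>. \<omega> \<in> space M \<Longrightarrow> H \<omega> = layer m j (F \<omega>)"
  shows "L_defined M \<G> H"
  unfolding L_defined_def
proof (intro ballI)
  fix G\<^sub>1 G\<^sub>2 assume G12: "G\<^sub>1 \<in> \<G>" "G\<^sub>2 \<in> \<G>"
  with G have [measurable]: "G\<^sub>1 \<in> borel_measurable M" "G\<^sub>2 \<in> borel_measurable M"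
    by auto
  have [measurable]: "H \<in> borel_measurable M"
    using measurable_compose[OF F measurable_layer[of m j]] by (simp add: H cong: measurable_cong)
  have p: "pairing F G\<^sub>1 G\<^sub>2 \<in> borel_measurable M" "pairing H G\<^sub>1 G\<^sub>2 \<in> borel_measurable M"
    unfolding pairing_def[abs_def] by measurable
  \<comment> \<open>Stated for arbitrary functions so that it covers the positive parts, with
    \<open>G\<^sub>1\<close>, \<open>G\<^sub>2\<close>, and the negative parts, with their
    negations.\<close>
  have bound: "(\<integral>\<^sup>+\<omega>. ennreal (H \<omega>) * ennreal (G\<^sub>1' \<omega>) + ennreal (- H \<omega>) * ennreal (G\<^sub>2' \<omega>) \<partial>M)
      \<le> ennreal (real m) * (\<integral>\<^sup>+\<omega>. ennreal (F \<omega>) * ennreal (G\<^sub>1' \<omega>) + ennreal (- F \<omega>) * ennreal (G\<^sub>2' \<omega>) \<partial>M)"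
    if [measurable]: "G\<^sub>1' \<in> borel_measurable M" "G\<^sub>2' \<in> borel_measurable M" for G\<^sub>1' G\<^sub>2' :: "'a \<Rightarrow> real"
  proof -
    have "(\<integral>\<^sup>+\<omega>. ennreal (H \<omega>) * ennreal (G\<^sub>1' \<omega>) + ennreal (- H \<omega>) * ennreal (G\<^sub>2' \<omega>) \<partial>M)
        \<le> (\<integral>\<^sup>+\<omega>. ennreal (real m) * (ennreal (F \<omega>) * ennreal (G\<^sub>1' \<omega>) + ennreal (- F \<omega>) * ennreal (G\<^sub>2' \<omega>)) \<partial>M)"
    proof (rule nn_integral_mono)
      fix \<omega> assume "\<omega> \<in> space M"
      then show "ennreal (H \<omega>) * ennreal (G\<^sub>1' \<omega>) + ennreal (- H \<omega>) * ennreal (G\<^sub>2' \<omega>)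
          \<le> ennreal (real m) * (ennreal (F \<omega>) * ennreal (G\<^sub>1' \<omega>) + ennreal (- F \<omega>) * ennreal (G\<^sub>2' \<omega>))"
        unfolding distrib_left mult.assoc[symmetric]
        by (simp only: H) (intro add_mono mult_right_mono ennreal_layer_le[OF m] zero_le)
    qed
    also have "\<dots> = ennreal (real m) * (\<integral>\<^sup>+\<omega>. ennreal (F \<omega>) * ennreal (G\<^sub>1' \<omega>) + ennreal (- F \<omega>) * ennreal (G\<^sub>2' \<omega>) \<partial>M)"
      by (intro nn_integral_cmult) measurable
    finally show ?thesis .
  qed
  have bound_less_top: "a < top" if "a \<le> ennreal (real m) * b" "b < top" for a b
    using that by (elim le_less_trans) (simp add: ennreal_mult_less_top)
  have "has_expectation M (pairing F G\<^sub>1 G\<^sub>2)"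
    using L G12 by (auto simp: L_defined_def)
  then show "has_expectation M (pairing H G\<^sub>1 G\<^sub>2)"
    using p bound_less_top[OF bound[of G\<^sub>1 G\<^sub>2]]
      bound_less_top[OF bound[of "\<lambda>\<omega>. - G\<^sub>1 \<omega>" "\<lambda>\<omega>. - G\<^sub>2 \<omega>"]]
    unfolding has_expectation_def ennreal_pairing ennreal_uminus_pairing infinity_ennreal_def
    by auto
qed

section \<open>Equivalence of the inequalities for functions and for sets\<close>

theorem theorem5p4:
  fixes \<sigma> :: "'a::metric_space measure"
    and \<pi> :: "'a set measure"
    and \<G> :: "('a set \<Rightarrow> real) set"
    and c :: real
    and nrm :: "'a set \<Rightarrow> ('a \<Rightarrow> real) \<Rightarrow> ennreal"
    and D :: "('a set \<Rightarrow> real) \<Rightarrow> 'a \<Rightarrow> 'a set \<Rightarrow> real"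
  assumes "sets \<sigma> = sets borel"
    and "finite_measure \<sigma>"
    and "\<And>x. emeasure \<sigma> {x} = 0"
    and "poisson_measure \<sigma> \<pi>"
    and "\<G> \<noteq> {}"
    and "\<G> \<subseteq> borel_measurable \<pi>"
    and "c \<ge> 0"
    and "nrm \<in> {norm_L1_intensity \<sigma>, norm_L1_config, norm_Linf \<sigma>}"
    and "D \<in> {diff_plus, diff_minus}"
  shows
    "(\<forall>F\<in>borel_measurable \<pi>. L_defined \<pi> \<G> F \<longrightarrow>
        ereal c * L_functional \<pi> \<G> F \<le> enn2ereal (\<integral>\<^sup>+\<omega>. nrm \<omega> (\<lambda>x. D F x \<omega>) \<partial>\<pi>))
     \<longleftrightarrow>
     (\<forall>A\<in>sets \<pi>.
        (L_defined \<pi> \<G> (indicator A) \<longrightarrow>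
          ereal c * L_functional \<pi> \<G> (indicator A)
            \<le> enn2ereal (\<integral>\<^sup>+\<omega>. nrm \<omega> (\<lambda>x. D (indicator A) x \<omega>) \<partial>\<pi>)) \<and>
        (L_defined \<pi> \<G> (\<lambda>\<omega>. - indicator A \<omega>) \<longrightarrow>
          ereal c * L_functional \<pi> \<G> (\<lambda>\<omega>. - indicator A \<omega>)
            \<le> enn2ereal (\<integral>\<^sup>+\<omega>. nrm \<omega> (\<lambda>x. D (\<lambda>\<omega>. - indicator A \<omega>) x \<omega>) \<partial>\<pi>)))"
    (is "?functions \<longleftrightarrow> ?sets")
proof
  assume ?functions
  then show ?sets
    by (intro ballI conjI impI) (auto intro!: borel_measurable_indicator borel_measurable_uminus)
next
  assume *: ?sets
  show ?functions
  proof (intro ballI impI)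
    fix F assume F[measurable]: "F \<in> borel_measurable \<pi>" and L: "L_defined \<pi> \<G> F"
    define R where "R H = (\<integral>\<^sup>+\<omega>. nrm \<omega> (\<lambda>x. D H x \<omega>) \<partial>\<pi>)" for H
    \<comment> \<open>The expected slack; once it is finite, the error \<open>2 / m * K\<close>
      vanishes in the limit.\<close>
    define K where "K = (\<integral>\<^sup>+\<omega>. emeasure \<sigma> UNIV + emeasure (config_measure \<omega>) UNIV + 1 \<partial>\<pi>)"
    interpret \<sigma>: finite_measure \<sigma> by fact
    interpret \<pi>: prob_space \<pi>
      using assms(4) by (simp add: poisson_measure_def)
    have sets: "sets \<pi> = sets config_algebra"
      using assms(4) by (simp add: poisson_measure_def)
    have "(\<lambda>\<omega>. emeasure (config_measure \<omega>) UNIV) \<in> borel_measurable \<pi>"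
      using measurable_emeasure_config_measure[of UNIV] by (simp add: measurable_cong_sets[OF sets refl])
    then have "K < top"
      using poisson_total_mass(2)[OF assms(4)] \<sigma>.emeasure_finite[of UNIV]
      by (simp add: K_def nn_integral_add \<pi>.emeasure_space_1 flip: less_top)
    have "ennreal c * (\<integral>\<^sup>+\<omega>. ennreal (pairing F G\<^sub>1 G\<^sub>2 \<omega>) \<partial>\<pi>)
        \<le> R F + ennreal c * (\<integral>\<^sup>+\<omega>. ennreal (- pairing F G\<^sub>1 G\<^sub>2 \<omega>) \<partial>\<pi>)"
      if G12: "G\<^sub>1 \<in> \<G>" "G\<^sub>2 \<in> \<G>" for G\<^sub>1 G\<^sub>2
    proof -
      have [measurable]: "G\<^sub>1 \<in> borel_measurable \<pi>" "G\<^sub>2 \<in> borel_measurable \<pi>"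
        using assms(6) G12 by auto
      \<comment> \<open>\<open>P m\<close> and \<open>N m\<close> are the positive and negative
        parts of the pairing for the rounding of \<open>F\<close>.\<close>
      define P where "P m \<omega> = ennreal (stair m (F \<omega>)) * ennreal (G\<^sub>1 \<omega>)
        + ennreal (stair m (- F \<omega>)) * ennreal (G\<^sub>2 \<omega>)" for m \<omega>
      define N where "N m \<omega> = ennreal (stair m (F \<omega>)) * ennreal (- G\<^sub>1 \<omega>)
        + ennreal (stair m (- F \<omega>)) * ennreal (- G\<^sub>2 \<omega>)" for m \<omega>
      have P[measurable]: "P m \<in> borel_measurable \<pi>" for m
        unfolding P_def by measurable
      \<comment> \<open>The negative part on the right is already that of \<open>F\<close> itself,
        since rounding only decreases it. Only the left side depends on a limit of integrals, so
        Fatou's lemma is enough.\<close>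
      have step: "ennreal c * (\<integral>\<^sup>+\<omega>. P m \<omega> \<partial>\<pi>) \<le>
          R F + ennreal (2 / real m) * K + ennreal c * (\<integral>\<^sup>+\<omega>. ennreal (- pairing F G\<^sub>1 G\<^sub>2 \<omega>) \<partial>\<pi>)"
        if m: "m > 0" for m
      proof -
        let ?J = "{1..m^2} \<times> (UNIV :: bool set)"
        \<comment> \<open>The layers are written as indicators of measurable sets, so that the
          condition on sets applies literally; they agree with \<open>layer m j (F \<omega>)\<close>
          on the space.\<close>
        define H where "H j = (case j of (i, p) \<Rightarrow>
          if p then indicator {\<omega>\<in>space \<pi>. real i / real m \<le> F \<omega>}
          else (\<lambda>\<omega>. - indicator {\<omega>\<in>space \<pi>. real i / real m \<le> - F \<omega>} \<omega> :: real))" for j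
        have H: "H j \<omega> = layer m j (F \<omega>)" if "\<omega> \<in> space \<pi>" for j \<omega>
          using that by (cases j) (auto simp: H_def layer_def)
        define P' where "P' j = (\<integral>\<^sup>+\<omega>. ennreal (layer m j (F \<omega>)) * ennreal (G\<^sub>1 \<omega>)
          + ennreal (- layer m j (F \<omega>)) * ennreal (G\<^sub>2 \<omega>) \<partial>\<pi>)" for j
        define N' where "N' j = (\<integral>\<^sup>+\<omega>. ennreal (layer m j (F \<omega>)) * ennreal (- G\<^sub>1 \<omega>)
          + ennreal (- layer m j (F \<omega>)) * ennreal (- G\<^sub>2 \<omega>) \<partial>\<pi>)" for j
        have layer_le: "ennreal c * P' j \<le> R (H j) + ennreal c * N' j" if j: "j \<in> ?J" for j
        proof -
          have LH: "L_defined \<pi> \<G> (H j)"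
            using F assms(6) L m j H by (rule L_defined_layer)
          obtain i p where ip: "j = (i, p)"
            by (cases j)
          have "{\<omega>\<in>space \<pi>. real i / real m \<le> F \<omega>} \<in> sets \<pi>"
            "{\<omega>\<in>space \<pi>. real i / real m \<le> - F \<omega>} \<in> sets \<pi>"
            by measurable
          with * LH have "ereal c * L_functional \<pi> \<G> (H j) \<le> enn2ereal (R (H j))"
            unfolding R_def by (cases p) (auto simp: H_def ip)
          then have "ennreal c * (\<integral>\<^sup>+\<omega>. ennreal (pairing (H j) G\<^sub>1 G\<^sub>2 \<omega>) \<partial>\<pi>)
              \<le> R (H j) + ennreal c * (\<integral>\<^sup>+\<omega>. ennreal (- pairing (H j) G\<^sub>1 G\<^sub>2 \<omega>) \<partial>\<pi>)"
            using L_functional_le_iff[OF assms(7,5) LH] G12 by blast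
          then show ?thesis
            unfolding ennreal_pairing ennreal_uminus_pairing P'_def N'_def by (simp add: H cong: nn_integral_cong_simp)
        qed
        have sum_P': "(\<Sum>j\<in>?J. ennreal (1 / real m) * P' j) = (\<integral>\<^sup>+\<omega>. P m \<omega> \<partial>\<pi>)"
          and sum_N': "(\<Sum>j\<in>?J. ennreal (1 / real m) * N' j) = (\<integral>\<^sup>+\<omega>. N m \<omega> \<partial>\<pi>)"
          unfolding P'_def N'_def P_def N_def by (intro sum_nn_integral_layers; measurable)+
        have "ennreal c * (\<integral>\<^sup>+\<omega>. P m \<omega> \<partial>\<pi>) = (\<Sum>j\<in>?J. ennreal (1 / real m) * (ennreal c * P' j))"
          unfolding sum_P'[symmetric] by (simp only: sum_distrib_left mult.left_commute)
        also have "\<dots> \<le> (\<Sum>j\<in>?J. ennreal (1 / real m) * (R (H j) + ennreal c * N' j))"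
          by (intro sum_mono mult_left_mono layer_le) auto
        also have "\<dots> = (\<Sum>j\<in>?J. ennreal (1 / real m) * R (H j)) + ennreal c * (\<integral>\<^sup>+\<omega>. N m \<omega> \<partial>\<pi>)"
          unfolding sum_N'[symmetric]
          by (simp only: sum_distrib_left mult.left_commute distrib_left sum.distrib)
        also have "(\<Sum>j\<in>?J. ennreal (1 / real m) * R (H j)) \<le> R F + ennreal (2 / real m) * K"
          unfolding R_def K_def
          by (intro sum_norm_diff_layers_le assms m H) auto
        also have "(\<integral>\<^sup>+\<omega>. N m \<omega> \<partial>\<pi>) \<le> (\<integral>\<^sup>+\<omega>. ennreal (- pairing F G\<^sub>1 G\<^sub>2 \<omega>) \<partial>\<pi>)"
        proof (rule nn_integral_mono)
          have "ennreal (stair m r) \<le> ennreal r" for r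
            using ennreal_leI[OF stair_le[OF m, of r]] by (simp add: max.commute)
          then show "N m \<omega> \<le> ennreal (- pairing F G\<^sub>1 G\<^sub>2 \<omega>)" for \<omega>
            unfolding N_def ennreal_uminus_pairing by (intro add_mono mult_right_mono zero_le)
        qed
        finally show ?thesis
          by (simp add: add_mono mult_left_mono)
      qed
      have "ennreal c * (\<integral>\<^sup>+\<omega>. ennreal (pairing F G\<^sub>1 G\<^sub>2 \<omega>) \<partial>\<pi>) =
          (\<integral>\<^sup>+\<omega>. ennreal c * ennreal (pairing F G\<^sub>1 G\<^sub>2 \<omega>) \<partial>\<pi>)"
        unfolding pairing_def by (intro nn_integral_cmult[symmetric]) measurable
      also have "\<dots> = (\<integral>\<^sup>+\<omega>. liminf (\<lambda>n. ennreal c * P (Suc n) \<omega>) \<partial>\<pi>)"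
        unfolding P_def ennreal_pairing
        by (intro nn_integral_cong lim_imp_Liminf[symmetric] ennreal_tendsto_cmult tendsto_stair_pairing) auto
      \<comment> \<open>Fatou's lemma; the index \<open>Suc n\<close> respects the condition
        \<open>m > 0\<close> of \<open>step\<close>.\<close>
      also have "\<dots> \<le> liminf (\<lambda>n. \<integral>\<^sup>+\<omega>. ennreal c * P (Suc n) \<omega> \<partial>\<pi>)"
        by (intro nn_integral_liminf) measurable
      also have "\<dots> = liminf (\<lambda>n. ennreal c * (\<integral>\<^sup>+\<omega>. P (Suc n) \<omega> \<partial>\<pi>))"
        by (simp add: nn_integral_cmult)
      also have "\<dots> \<le> liminf (\<lambda>n. R F + ennreal (2 / real (Suc n)) * K
          + ennreal c * (\<integral>\<^sup>+\<omega>. ennreal (- pairing F G\<^sub>1 G\<^sub>2 \<omega>) \<partial>\<pi>))"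
        by (intro Liminf_mono always_eventually allI step) simp
      also have "\<dots> = R F + ennreal c * (\<integral>\<^sup>+\<omega>. ennreal (- pairing F G\<^sub>1 G\<^sub>2 \<omega>) \<partial>\<pi>)"
      proof (rule lim_imp_Liminf)
        have "(\<lambda>n. K * ennreal (2 / real (Suc n))) \<longlonglongrightarrow> K * ennreal 0"
          using \<open>K < top\<close>
          by (intro ennreal_tendsto_cmult tendsto_ennrealI LIMSEQ_Suc lim_const_over_n)
        then have "(\<lambda>n. R F + K * ennreal (2 / real (Suc n))
            + ennreal c * (\<integral>\<^sup>+\<omega>. ennreal (- pairing F G\<^sub>1 G\<^sub>2 \<omega>) \<partial>\<pi>))
          \<longlonglongrightarrow> R F + K * ennreal 0 + ennreal c * (\<integral>\<^sup>+\<omega>. ennreal (- pairing F G\<^sub>1 G\<^sub>2 \<omega>) \<partial>\<pi>)"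
          by (intro tendsto_add tendsto_const)
        then show "(\<lambda>n. R F + ennreal (2 / real (Suc n)) * K
            + ennreal c * (\<integral>\<^sup>+\<omega>. ennreal (- pairing F G\<^sub>1 G\<^sub>2 \<omega>) \<partial>\<pi>))
          \<longlonglongrightarrow> R F + ennreal c * (\<integral>\<^sup>+\<omega>. ennreal (- pairing F G\<^sub>1 G\<^sub>2 \<omega>) \<partial>\<pi>)"
          by (simp add: mult.commute)
      qed simp
      finally show ?thesis .
    qed
    then show "ereal c * L_functional \<pi> \<G> F \<le> enn2ereal (\<integral>\<^sup>+\<omega>. nrm \<omega> (\<lambda>x. D F x \<omega>) \<partial>\<pi>)"
      using L_functional_le_iff[OF assms(7,5) L] by (auto simp: R_def)
  qed
qed

end
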